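(* Let $P=\prod_{i\in[k]}X_{\iota(i)}^{\tau(i)}$ be a symbolic matrix product including symmetric variables, of degree $k$ with $\ell$ variables. Then $P$ is real-eigenvalued if and only if at least one of the following holds (indices modulo $k$): (1) $P$ is symmetric, i.e. $k$ is even and there exists $j\in[k]$ such that $\prod_{i=j+1}^{j+k}X_{\iota(i)}^{\tau(i)}=LL^T$ as formal words, where $L=\prod_{i=j+1}^{j+k/2}X_{\iota(i)}^{\tau(i)}$; or (2) $k$ is odd and there exists $j\in[k]$ such that $\tau(j+k)=\mathrm{sym}$ and $\prod_{i=j+1}^{j+k}X_{\iota(i)}^{\tau(i)}=LL^TX_{\iota(j+k)}^{\mathrm{sym}}$ as formal words, where $L=\prod_{i=j+1}^{j+(k-1)/2}X_{\iota(i)}^{\tau(i)}$.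
   Context: Let $X_1,\dots,X_\ell$ be formal variables. A symbolic matrix product including symmetric variables of degree $k$ is a formal word $P=\prod_{i=1}^kX_{\iota(i)}^{\tau(i)}$ with $\iota:[k]\to[\ell]$ and $\tau:[k]\to\{1,T,\mathrm{sym}\}$, such that whenever $\tau(i)=\mathrm{sym}$ for some $i$ with $\iota(i)=j$, then $\tau(i')=\mathrm{sym}$ for every $i'$ with $\iota(i')=j$ (such $X_j$ are called symmetric variables). Formal transposition acts on words by $(X_i^1)^T=X_i^T$, $(X_i^T)^T=X_i$, $(X_i^{\mathrm{sym}})^T=X_i^{\mathrm{sym}}$ and $(W_1W_2)^T=W_2^TW_1^T$; equality means equality as formal words. An admissible assignment for given $n\in\mathbb N$ consists of matrices $A_1,\dots,A_\ell\in\mathbb R^{n\times n}$ where $A_j$ is symmetric whenever $X_j$ is a symmetric variable; $P(A_1,\dots,A_\ell)$ is obtained by substituting $A_i$ for $X_i$ and $X_i^{\mathrm{sym}}$, and $A_i^T$ for $X_i^T$, and multiplying. $P$ is real-eigenvalued if for every $n$ and every admissible assignment, all (complex) eigenvalues of $P(A_1,\dots,A_\ell)$ are real. *)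

theory Defs
  imports "Jordan_Normal_Form.Char_Poly"
begin

datatype tag = Pl | Tr | Sy

(* a letter X_i^tau is the pair (i, tau); variables are indexed 0..<l; a word of degree k is a list of length k *)
type_synonym word = "(nat \<times> tag) list"

definition is_sym_var :: "word \<Rightarrow> nat \<Rightarrow> bool" where
  "is_sym_var w j = (\<exists>x\<in>set w. fst x = j \<and> snd x = Sy)"

definition symbolic_product :: "nat \<Rightarrow> nat \<Rightarrow> word \<Rightarrow> bool" where
  "symbolic_product l k w = (length w = k \<and> k \<ge> 1 \<and> (\<forall>x\<in>set w. fst x < l) \<and>
     (\<forall>x\<in>set w. \<forall>y\<in>set w. fst x = fst y \<longrightarrow> snd x = Sy \<longrightarrow> snd y = Sy))"

fun tr_letter :: "nat \<times> tag \<Rightarrow> nat \<times> tag" where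
  "tr_letter (i, Pl) = (i, Tr)"
| "tr_letter (i, Tr) = (i, Pl)"
| "tr_letter (i, Sy) = (i, Sy)"

definition wtrans :: "word \<Rightarrow> word" where
  "wtrans w = rev (map tr_letter w)"

fun eval_letter :: "(nat \<Rightarrow> real mat) \<Rightarrow> nat \<times> tag \<Rightarrow> real mat" where
  "eval_letter A (i, Pl) = A i"
| "eval_letter A (i, Tr) = transpose_mat (A i)"
| "eval_letter A (i, Sy) = A i"

definition eval_word :: "nat \<Rightarrow> (nat \<Rightarrow> real mat) \<Rightarrow> word \<Rightarrow> real mat" where
  "eval_word n A w = foldr (\<lambda>x M. eval_letter A x * M) w (1\<^sub>m n)"

definition admissible :: "nat \<Rightarrow> nat \<Rightarrow> word \<Rightarrow> (nat \<Rightarrow> real mat) \<Rightarrow> bool" where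
  "admissible l n w A = (\<forall>j<l. A j \<in> carrier_mat n n \<and> (is_sym_var w j \<longrightarrow> transpose_mat (A j) = A j))"

definition real_eigenvalued :: "nat \<Rightarrow> word \<Rightarrow> bool" where
  "real_eigenvalued l w = (\<forall>n A. admissible l n w A \<longrightarrow>
     (\<forall>c::complex. eigenvalue (map_mat complex_of_real (eval_word n A w)) c \<longrightarrow> c \<in> \<real>))"

end

(* Up to rotation, both forms in the theorem say that some rotation of w is a palindrome, i.e. equal
   to its own formal transpose.  The value of a palindrome is a real symmetric matrix, and rotating
   a product preserves its nonzero eigenvalues; this gives one direction.

   For the other, let the variables act on the cycle with k vertices whose edges are labelled by
   the letters of w: X moves along an X-labelled edge, with weight zeta = exp(i pi / 2k) clockwise
   and its conjugate counterclockwise.  The (u, v) entry of the product is then the sum of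
   zeta^d over the displacements d of the walks from u to v that spell w, and a closed walk has
   d = 0, k or -k, that is, weight 1, i or -i.  A walk with d = -k from u says that a reflection
   of the cycle carries w to its formal transpose; if k is odd, or if u is even, it forces a
   palindromic rotation.  For even k the displacements are even, so the product preserves the span
   of the even vertices.  Hence, without palindromic rotations, the trace of the product (for even
   k: of its restriction to the even vertices) has positive imaginary part, the walk spelling w
   from vertex 0 being among those counted, and there is a nonreal eigenvalue.  Replacing a complex
   matrix by a real one of twice the size turns adjoints into transposes. *)
theory Submission
  imports Defs "Jordan_Normal_Form.Schur_Decomposition"
begin

section \<open>Traces and eigenvalues of matrices\<close>

definition mat_trace :: "'a :: comm_semiring_0 mat \<Rightarrow> 'a" where
  "mat_trace A = (\<Sum>i<dim_row A. A $$ (i, i))"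

lemma mat_trace_comm:
  assumes "A \<in> carrier_mat n m" "B \<in> carrier_mat m n"
  shows "mat_trace (A * B) = mat_trace (B * A)"
proof -
  have "mat_trace (A * B) = (\<Sum>i<n. \<Sum>j<m. A $$ (i, j) * B $$ (j, i))"
    using assms by (auto simp: mat_trace_def scalar_prod_def lessThan_atLeast0 intro!: sum.cong)
  also have "\<dots> = (\<Sum>j<m. \<Sum>i<n. B $$ (j, i) * A $$ (i, j))"
    by (subst sum.swap) (simp add: mult.commute)
  also have "\<dots> = mat_trace (B * A)"
    using assms by (auto simp: mat_trace_def scalar_prod_def lessThan_atLeast0 intro!: sum.cong)
  finally show ?thesis .
qed

text \<open>A Schur decomposition conjugates \<open>A\<close> to a matrix whose diagonal lists the
  roots of the characteristic polynomial, so the trace is their sum. If all of them were real, the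
  trace would be real too.\<close>

lemma nonreal_eigenvalue_of_nonreal_trace:
  fixes A :: "complex mat"
  assumes A: "A \<in> carrier_mat n n" and tr: "Im (mat_trace A) \<noteq> 0"
  obtains c where "eigenvalue A c" "c \<notin> \<real>"
proof -
  obtain as where as: "char_poly A = (\<Prod>a\<leftarrow>as. [:- a, 1:])" "length as = n"
    using char_poly_factorized[OF A] by blast
  obtain B P Q where BPQ: "schur_decomposition A as = (B, P, Q)"
    using prod_cases3 by blast
  from schur_decomposition[OF A as(1) BPQ]
  have wit: "similar_mat_wit A B P Q" and diag: "diag_mat B = as"
    by auto
  note c = similar_mat_witD2[OF A wit]
  have "mat_trace A = mat_trace (P * (B * Q))"
    using c by (simp add: assoc_mult_mat[of _ n n _ n _ n])
  also have "\<dots> = mat_trace ((B * Q) * P)"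
    using c by (intro mat_trace_comm[of _ n n]) auto
  also have "\<dots> = mat_trace (B * (Q * P))"
    using c by (simp add: assoc_mult_mat[of _ n n _ n _ n])
  also have "\<dots> = mat_trace B"
    using c by simp
  also have "\<dots> = sum_list (diag_mat B)"
    by (simp add: mat_trace_def diag_mat_def sum_list_sum_nth lessThan_atLeast0)
  finally have sum: "mat_trace A = sum_list as"
    using diag by simp
  have "\<exists>c\<in>set as. c \<notin> \<real>"
  proof (rule ccontr)
    assume "\<not> ?thesis"
    then have "sum_list as \<in> \<real>"
      by (induction as) auto
    then show False
      using tr sum by (simp add: complex_is_Real_iff)
  qed
  then obtain c where c: "c \<in> set as" "c \<notin> \<real>"
    by blast
  from c(1) have "poly (char_poly A) c = 0"
    unfolding as(1) by (auto simp: poly_prod_list prod_list_zero_iff)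
  then have "eigenvalue A c"
    using eigenvalue_root_char_poly[OF A] by simp
  then show ?thesis
    using c(2) that by blast
qed

text \<open>An eigenvector \<open>v\<close> of \<open>A * B\<close> yields the eigenvector
  \<open>B *\<^sub>v v\<close> of \<open>B * A\<close>. It does not vanish because \<open>A\<close>
  maps it to a nonzero multiple of \<open>v\<close>.\<close>

lemma eigenvalue_mult_commute:
  fixes A B :: "'a :: field mat"
  assumes A: "A \<in> carrier_mat n n" and B: "B \<in> carrier_mat n n"
    and ev: "eigenvalue (A * B) c" and "c \<noteq> 0"
  shows "eigenvalue (B * A) c"
proof -
  from ev obtain v where v: "v \<in> carrier_vec n" "v \<noteq> 0\<^sub>v n" "(A * B) *\<^sub>v v = c \<cdot>\<^sub>v v"
    using A by (auto simp: eigenvalue_def eigenvector_def)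
  have Bv: "B *\<^sub>v v \<in> carrier_vec n"
    using B v by auto
  have ABv: "A *\<^sub>v (B *\<^sub>v v) = c \<cdot>\<^sub>v v"
    using v A B by (simp add: assoc_mult_mat_vec[of _ n n _ n])
  have "B *\<^sub>v v \<noteq> 0\<^sub>v n"
  proof
    assume "B *\<^sub>v v = 0\<^sub>v n"
    moreover have "A *\<^sub>v 0\<^sub>v n = 0\<^sub>v n"
      using A by (intro eq_vecI) auto
    ultimately have "c \<cdot>\<^sub>v v = 0\<^sub>v n"
      using ABv by simp
    then have "inverse c \<cdot>\<^sub>v (c \<cdot>\<^sub>v v) = 0\<^sub>v n"
      by (simp del: smult_smult_assoc) (intro eq_vecI; simp)
    then show False
      using v(2) \<open>c \<noteq> 0\<close> by (simp add: smult_smult_assoc)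
  qed
  moreover have "(B * A) *\<^sub>v (B *\<^sub>v v) = c \<cdot>\<^sub>v (B *\<^sub>v v)"
    using A B v Bv by (simp add: assoc_mult_mat_vec[of _ n n _ n] ABv mult_mat_vec)
  ultimately show ?thesis
    using Bv B by (auto simp: eigenvalue_def eigenvector_def)
qed

text \<open>The pairing of \<open>v\<close> with \<open>C *\<^sub>v conjugate v\<close> is computed
  twice. Real entries give the factor \<open>cnj c\<close>; moving the symmetric \<open>C\<close> to
  the other argument gives \<open>c\<close>.\<close>

lemma eigenvalue_symmetric_real:
  fixes A :: "real mat"
  assumes A: "A \<in> carrier_mat n n" and sym: "transpose_mat A = A"
    and ev: "eigenvalue (map_mat complex_of_real A) c"
  shows "c \<in> \<real>"
proof -
  define C where "C = map_mat complex_of_real A"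
  have C: "C \<in> carrier_mat n n"
    using A by (simp add: C_def)
  have CT: "transpose_mat C = C"
    using sym by (metis C_def map_mat_transpose)
  from ev obtain v where v: "v \<in> carrier_vec n" "v \<noteq> 0\<^sub>v n" "C *\<^sub>v v = c \<cdot>\<^sub>v v"
    using A by (auto simp: eigenvalue_def eigenvector_def C_def)
  have "C *\<^sub>v conjugate v = conjugate (C *\<^sub>v v)"
    using A v(1) by (intro eq_vecI) (auto simp: C_def scalar_prod_def cnj_sum)
  also have "\<dots> = cnj c \<cdot>\<^sub>v conjugate v"
    by (simp add: v conjugate_smult_vec)
  finally have Ccv: "C *\<^sub>v conjugate v = cnj c \<cdot>\<^sub>v conjugate v" .
  have "cnj c * (v \<bullet>c v) = v \<bullet> (C *\<^sub>v conjugate v)"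
    using v by (simp add: Ccv scalar_prod_smult_right)
  also have "\<dots> = (transpose_mat C *\<^sub>v v) \<bullet> conjugate v"
    using transpose_vec_mult_scalar[of "transpose_mat C" n n "v" "conjugate v"] C v
    by (simp add: CT comm_scalar_prod[of _ n] transpose_vec_mult_scalar)
  also have "\<dots> = c * (v \<bullet>c v)"
    using v by (simp add: CT)
  finally have "cnj c = c"
    using v by (simp add: conjugate_square_eq_0_vec[of v n])
  then show ?thesis
    by (simp add: Reals_cnj_iff)
qed

section \<open>Values of words and formal transposition\<close>

lemma eval_letter_carrier:
  assumes "admissible l n w A" "fst x < l"
  shows "eval_letter A x \<in> carrier_mat n n"
  using assms by (cases x; cases "snd x") (auto simp: admissible_def)

lemma eval_word_carrier:
  assumes "admissible l n w A" "\<forall>x\<in>set xs. fst x < l"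
  shows "eval_word n A xs \<in> carrier_mat n n"
  using assms(2)
proof (induction xs)
  case (Cons x xs)
  then show ?case
    using eval_letter_carrier[OF assms(1), of x] by (auto simp: eval_word_def)
qed (simp add: eval_word_def)

lemma eval_word_append:
  assumes "admissible l n w A" "\<forall>x\<in>set (xs @ ys). fst x < l"
  shows "eval_word n A (xs @ ys) = eval_word n A xs * eval_word n A ys"
  using assms(2)
proof (induction xs)
  case Nil
  then show ?case
    using eval_word_carrier[OF assms(1), of ys] by (simp add: eval_word_def)
next
  case (Cons x xs)
  have "eval_word n A (x # zs) = eval_letter A x * eval_word n A zs" for zs
    by (simp add: eval_word_def)
  then show ?case
    using Cons eval_word_carrier[OF assms(1), of xs] eval_word_carrier[OF assms(1), of ys]
      eval_letter_carrier[OF assms(1), of x]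
    by (simp add: assoc_mult_mat[of _ n n _ n _ n])
qed

lemma fst_tr_letter [simp]: "fst (tr_letter x) = fst x"
  by (cases x; cases "snd x") auto

lemma tr_letter_tr_letter [simp]: "tr_letter (tr_letter x) = x"
  by (cases x; cases "snd x") auto

lemma tr_letter_fixed_iff: "tr_letter x = x \<longleftrightarrow> snd x = Sy"
  by (cases x; cases "snd x") auto

lemma wtrans_append: "wtrans (xs @ ys) = wtrans ys @ wtrans xs"
  by (simp add: wtrans_def)

lemma wtrans_wtrans [simp]: "wtrans (wtrans xs) = xs"
  by (simp add: wtrans_def rev_map comp_def)

lemma length_wtrans [simp]: "length (wtrans xs) = length xs"
  by (simp add: wtrans_def)

text \<open>The case of interest is the tag \<open>Sy\<close>: since the letter occurs in
  \<open>w\<close>, its variable is symmetric, and admissibility makes the matrix symmetric.\<close>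

lemma transpose_eval_letter:
  assumes "admissible l n w A" "x \<in> set w" "fst x < l"
  shows "transpose_mat (eval_letter A x) = eval_letter A (tr_letter x)"
  using assms by (cases x; cases "snd x") (auto simp: admissible_def is_sym_var_def, metis fst_conv snd_conv)

lemma transpose_eval_word:
  assumes adm: "admissible l n w A" and w: "\<forall>x\<in>set w. fst x < l" and "set xs \<subseteq> set w"
  shows "transpose_mat (eval_word n A xs) = eval_word n A (wtrans xs)"
  using assms(3)
proof (induction xs)
  case Nil
  then show ?case
    by (simp add: eval_word_def wtrans_def)
next
  case (Cons x xs)
  have "fst x < l" "\<forall>y\<in>set xs. fst y < l"
    using Cons.prems w by auto
  note c = eval_letter_carrier[OF adm this(1)] eval_word_carrier[OF adm this(2)]
  have x: "eval_word n A [tr_letter x] = eval_letter A (tr_letter x)"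
    using eval_letter_carrier[OF adm, of "tr_letter x"] \<open>fst x < l\<close> by (simp add: eval_word_def)
  have "transpose_mat (eval_word n A (x # xs)) = transpose_mat (eval_letter A x * eval_word n A xs)"
    by (simp add: eval_word_def)
  also have "\<dots> = eval_word n A (wtrans xs) * eval_letter A (tr_letter x)"
    using Cons transpose_eval_letter[OF adm, of x] \<open>fst x < l\<close> by (simp add: transpose_mult[OF c])
  also have "\<dots> = eval_word n A (wtrans xs @ [tr_letter x])"
    using eval_word_append[OF adm, of "wtrans xs" "[tr_letter x]"] \<open>fst x < l\<close>
      \<open>\<forall>y\<in>set xs. fst y < l\<close> by (auto simp: x wtrans_def)
  finally show ?case
    by (simp add: wtrans_def)
qed

lemma real_eigenvalued_of_palindromic_rotation:
  assumes w: "\<forall>x\<in>set w. fst x < l" and pal: "wtrans (rotate j w) = rotate j w"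
  shows "real_eigenvalued l w"
  unfolding real_eigenvalued_def
proof (intro allI impI)
  fix n A c
  assume adm: "admissible l n w A"
    and ev: "eigenvalue (map_mat complex_of_real (eval_word n A w)) c"
  let ?C = "map_mat complex_of_real"
  define i where "i = j mod length w"
  define xs ys where "xs = take i w" and "ys = drop i w"
  have w_eq: "w = xs @ ys" and r_eq: "rotate j w = ys @ xs"
    by (simp_all add: xs_def ys_def i_def rotate_drop_take)
  have l: "\<forall>x\<in>set xs. fst x < l" "\<forall>x\<in>set ys. fst x < l"
    using w w_eq by auto
  note c = eval_word_carrier[OF adm l(1)] eval_word_carrier[OF adm l(2)]
  let ?X = "eval_word n A xs" and ?Y = "eval_word n A ys"
  have w_val: "eval_word n A w = ?X * ?Y"
    using eval_word_append[OF adm, of xs ys] l w_eq by auto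
  have r_val: "eval_word n A (rotate j w) = ?Y * ?X"
    using eval_word_append[OF adm, of ys xs] l r_eq by auto
  show "c \<in> \<real>"
  \<comment> \<open>Zero is real, so only nonzero eigenvalues have to survive the exchange of the
    two factors.\<close>
  proof (cases "c = 0")
    case False
    have "eigenvalue (?C ?X * ?C ?Y) c"
      using ev c by (simp add: w_val of_real_hom.mat_hom_mult[of _ n n _ n])
    then have "eigenvalue (?C ?Y * ?C ?X) c"
      using eigenvalue_mult_commute[of "?C ?X" n "?C ?Y" c] c False by simp
    then have "eigenvalue (?C (eval_word n A (rotate j w))) c"
      using c by (simp add: r_val of_real_hom.mat_hom_mult[of _ n n _ n])
    moreover have "transpose_mat (eval_word n A (rotate j w)) = eval_word n A (rotate j w)"
      using transpose_eval_word[OF adm w, of "rotate j w"] pal by simp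
    moreover have "eval_word n A (rotate j w) \<in> carrier_mat n n"
      using c by (simp add: r_val)
    ultimately show ?thesis
      using eigenvalue_symmetric_real by blast
  qed simp
qed

section \<open>Normal forms of words with a palindromic rotation\<close>

lemma palindromic_rotation_iff:
  assumes len: "length w = k" and "k > 0"
  shows "(\<exists>j. wtrans (rotate j w) = rotate j w) \<longleftrightarrow>
    ((even k \<and> (\<exists>j<k. let r = rotate j w; L = take (k div 2) r in r = L @ wtrans L)) \<or>
     (odd k \<and> (\<exists>j<k. let r = rotate j w; L = take ((k - 1) div 2) r in
        snd (last r) = Sy \<and> r = L @ wtrans L @ [(fst (last r), Sy)])))"
    (is "?P \<longleftrightarrow> (even k \<and> ?E) \<or> (odd k \<and> ?O)")
proof
  assume ?P
  then obtain j where pal: "wtrans (rotate j w) = rotate j w"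
    by blast
  define r where "r = rotate j w"
  define h where "h = k div 2"
  have len_r: "length r = k"
    by (simp add: r_def len)
  show "(even k \<and> ?E) \<or> (odd k \<and> ?O)"
  proof (cases "even k")
    case True
    then have k: "k = h + h"
      by (auto simp: h_def)
    have "wtrans (drop h r) @ wtrans (take h r) = take h r @ drop h r"
      using pal by (simp flip: wtrans_append r_def)
    then have "wtrans (take h r) = drop h r"
      using len_r k by (subst (asm) append_eq_append_conv) auto
    then have "r = take h r @ wtrans (take h r)"
      by simp
    moreover have "r = rotate (j mod k) w"
      unfolding r_def using rotate_conv_mod[of j w] unfolding len .
    ultimately have ?E
      using \<open>k > 0\<close> by (intro exI[of _ "j mod k"]) (simp add: h_def Let_def)
    then show ?thesis
      using True by blast
  next
    case False
    then have k: "k = h + Suc h"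
      unfolding h_def by presburger
    define L s R where "L = take h r" and "s = r ! h" and "R = drop (Suc h) r"
    have r: "r = L @ s # R"
      unfolding L_def s_def R_def using len_r k by (intro id_take_nth_drop) simp
    have len_LR: "length L = h" "length R = h"
      using len_r k by (simp_all add: L_def R_def)
    \<comment> \<open>Comparing blocks of equal length shows that the middle letter is its own
      transpose, which forces the tag \<open>Sy\<close>.\<close>
    have "wtrans R @ tr_letter s # wtrans L = L @ s # R"
      using pal by (simp add: wtrans_def flip: r_def) (simp add: r)
    then have "tr_letter s = s" and R: "wtrans L = R"
      using len_LR by (subst (asm) append_eq_append_conv; simp)+
    then have s: "snd s = Sy"
      by (simp add: tr_letter_fixed_iff)
    \<comment> \<open>Rotating further, past \<open>L\<close> and the middle letter, brings
      \<open>s\<close> to the end. The first half is then \<open>R\<close>, followed by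
      \<open>L\<close>, which is its transpose.\<close>
    define i where "i = (Suc h + j) mod k"
    have "rotate i w = rotate (Suc h) r"
      unfolding i_def r_def rotate_rotate using rotate_conv_mod[of "Suc h + j" w] len by simp
    also have "\<dots> = R @ L @ [s]"
      using rotate_append[of "L @ [s]" R] len_LR r by simp
    finally have "rotate i w = R @ wtrans R @ [s]"
      using R by (metis wtrans_wtrans)
    moreover have "take ((k - 1) div 2) (R @ wtrans R @ [s]) = R"
      using len_LR k by simp
    moreover have "s = (fst s, Sy)"
      using s by (simp add: prod_eq_iff)
    moreover have "i < k"
      using \<open>k > 0\<close> by (simp add: i_def)
    ultimately have ?O
      using s by (intro exI[of _ i]) (simp add: Let_def)
    then show ?thesis
      using False by blast
  qed
next
  assume "(even k \<and> ?E) \<or> (odd k \<and> ?O)"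
  then show ?P
  proof (elim disjE conjE)
    assume ?E
    then obtain j L where "rotate j w = L @ wtrans L"
      by (auto simp: Let_def)
    then have "wtrans (rotate j w) = rotate j w"
      by (simp add: wtrans_append)
    then show ?P
      by blast
  next
    assume ?O
    then obtain j L x where r: "rotate j w = L @ wtrans L @ [(x, Sy)]"
      by (auto simp: Let_def)
    \<comment> \<open>Moving the leading \<open>L\<close> to the end puts the symmetric letter in
      the middle, between a word and its transpose.\<close>
    have "rotate (length L + j) w = wtrans L @ [(x, Sy)] @ L"
      using rotate_append[of L "wtrans L @ [(x, Sy)]"] r by (simp flip: rotate_rotate)
    then have "wtrans (rotate (length L + j) w) = rotate (length L + j) w"
      by (simp add: wtrans_def rev_map comp_def)
    then show ?P
      by blast
  qed
qed

section \<open>From complex matrices to real assignments\<close>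

definition realify :: "complex mat \<Rightarrow> real mat" where
  "realify X = four_block_mat (map_mat Re X) (- map_mat Im X) (map_mat Im X) (map_mat Re X)"

definition adjoint_mat :: "complex mat \<Rightarrow> complex mat" where
  "adjoint_mat X = map_mat cnj (transpose_mat X)"

lemma realify_carrier: "X \<in> carrier_mat n n \<Longrightarrow> realify X \<in> carrier_mat (n + n) (n + n)"
  by (auto simp: realify_def)

lemma transpose_realify:
  assumes "X \<in> carrier_mat n n"
  shows "transpose_mat (realify X) = realify (adjoint_mat X)"
proof -
  have "transpose_mat (realify X) = four_block_mat (transpose_mat (map_mat Re X))
      (transpose_mat (map_mat Im X)) (transpose_mat (- map_mat Im X)) (transpose_mat (map_mat Re X))"
    unfolding realify_def using assms by (intro transpose_four_block_mat) auto
  also have "\<dots> = realify (adjoint_mat X)"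
    unfolding realify_def adjoint_mat_def
    by (intro arg_cong4[where f = four_block_mat] eq_matI) auto
  finally show ?thesis .
qed

text \<open>The vectors consisting of \<open>v\<close> and \<open>- \<i>\<close> times
  \<open>v\<close> form a subspace invariant under every \<open>realify X\<close>, on which it acts
  as \<open>X\<close> does on \<open>v\<close>. Eigenvectors of a product therefore lift with the
  same eigenvalue.\<close>

lemma realify_mult_lift:
  assumes X: "X \<in> carrier_mat n n" and v: "v \<in> carrier_vec n"
  shows "map_mat complex_of_real (realify X) *\<^sub>v (v @\<^sub>v (- \<i>) \<cdot>\<^sub>v v)
    = (X *\<^sub>v v) @\<^sub>v (- \<i>) \<cdot>\<^sub>v (X *\<^sub>v v)"
proof -
  let ?R = "map_mat (\<lambda>z. complex_of_real (Re z)) X"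
  let ?I = "map_mat (\<lambda>z. complex_of_real (Im z)) X"
  have "map_mat complex_of_real (realify X) = four_block_mat ?R (- ?I) ?I ?R"
    unfolding realify_def using X by (intro eq_matI) auto
  moreover have "four_block_mat ?R (- ?I) ?I ?R *\<^sub>v (v @\<^sub>v (- \<i>) \<cdot>\<^sub>v v)
      = (?R *\<^sub>v v + (- ?I) *\<^sub>v ((- \<i>) \<cdot>\<^sub>v v)) @\<^sub>v (?I *\<^sub>v v + ?R *\<^sub>v ((- \<i>) \<cdot>\<^sub>v v))"
    using X v by (intro four_block_mat_mult_vec[of _ n n _ n _ n]) auto
  moreover have "?R *\<^sub>v v + (- ?I) *\<^sub>v ((- \<i>) \<cdot>\<^sub>v v) = X *\<^sub>v v"
  proof (rule eq_vecI)
    fix i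
    assume "i < dim_vec (X *\<^sub>v v)"
    then have "(?R *\<^sub>v v + (- ?I) *\<^sub>v ((- \<i>) \<cdot>\<^sub>v v)) $ i =
        (\<Sum>j<n. (complex_of_real (Re (X $$ (i, j))) + \<i> * complex_of_real (Im (X $$ (i, j)))) * v $ j)"
      using X v by (simp add: scalar_prod_def lessThan_atLeast0 sum.distrib sum_negf algebra_simps)
    also have "\<dots> = (X *\<^sub>v v) $ i"
      using X v \<open>i < dim_vec (X *\<^sub>v v)\<close>
      by (simp add: scalar_prod_def lessThan_atLeast0 flip: complex_eq)
    finally show "(?R *\<^sub>v v + (- ?I) *\<^sub>v ((- \<i>) \<cdot>\<^sub>v v)) $ i = (X *\<^sub>v v) $ i" .
  qed (use X in auto)
  moreover have "?I *\<^sub>v v + ?R *\<^sub>v ((- \<i>) \<cdot>\<^sub>v v) = (- \<i>) \<cdot>\<^sub>v (X *\<^sub>v v)"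
  proof (rule eq_vecI)
    fix i
    assume "i < dim_vec ((- \<i>) \<cdot>\<^sub>v (X *\<^sub>v v))"
    then have i: "i < n"
      using X by simp
    have "(?I *\<^sub>v v + ?R *\<^sub>v ((- \<i>) \<cdot>\<^sub>v v)) $ i =
        (\<Sum>j<n. complex_of_real (Im (X $$ (i, j))) * v $ j + complex_of_real (Re (X $$ (i, j))) * (- \<i> * v $ j))"
      using X v i by (simp add: scalar_prod_def lessThan_atLeast0 sum_negf sum_subtractf)
    also have "\<dots> = (\<Sum>j<n. - \<i> * (X $$ (i, j) * v $ j))"
      by (intro sum.cong refl) (simp add: complex_eq_iff algebra_simps)
    also have "\<dots> = ((- \<i>) \<cdot>\<^sub>v (X *\<^sub>v v)) $ i"
      using X v i by (simp add: scalar_prod_def lessThan_atLeast0 sum_distrib_left)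
    finally show "(?I *\<^sub>v v + ?R *\<^sub>v ((- \<i>) \<cdot>\<^sub>v v)) $ i = ((- \<i>) \<cdot>\<^sub>v (X *\<^sub>v v)) $ i" .
  qed (use X in auto)
  ultimately show ?thesis
    by simp
qed

text \<open>By \<open>adj\<close>, a letter tagged \<open>Sy\<close> receives a Hermitian matrix,
  and the realification of such a matrix is symmetric. The family thus becomes an admissible real
  assignment of size \<open>n + n\<close> that keeps the eigenvalue.\<close>

lemma not_real_eigenvalued_of_complex_family:
  fixes G :: "nat \<times> tag \<Rightarrow> complex mat"
  assumes w: "\<forall>x\<in>set w. fst x < l"
    and sym: "\<forall>x\<in>set w. \<forall>y\<in>set w. fst x = fst y \<longrightarrow> snd x = Sy \<longrightarrow> snd y = Sy"
    and G: "\<And>x. G x \<in> carrier_mat n n"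
    and adj: "\<And>x. G (tr_letter x) = adjoint_mat (G x)"
    and ev: "eigenvalue (foldr (\<lambda>x M. G x * M) w (1\<^sub>m n)) c" and "c \<notin> \<real>"
  shows "\<not> real_eigenvalued l w"
proof
  assume re: "real_eigenvalued l w"
  \<comment> \<open>A symmetric variable must take the Hermitian matrix of its \<open>Sy\<close>
    letter. Any other variable takes that of its plain letter, and its transposed letter then
    follows from \<open>adj\<close>.\<close>
  define A where "A j = realify (G (j, if is_sym_var w j then Sy else Pl))" for j
  define prod where "prod xs = foldr (\<lambda>x M. G x * M) xs (1\<^sub>m n)" for xs
  define lift where "lift v = v @\<^sub>v (- \<i>) \<cdot>\<^sub>v v" for v :: "complex vec"
  let ?C = "map_mat complex_of_real"
  have A_carrier: "A j \<in> carrier_mat (n + n) (n + n)" for j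
    unfolding A_def by (rule realify_carrier[OF G])
  have A_transpose: "transpose_mat (A j) = realify (G (tr_letter (j, if is_sym_var w j then Sy else Pl)))" for j
    unfolding A_def adj by (rule transpose_realify[OF G])
  have adm: "admissible l (n + n) w A"
    using A_transpose by (auto simp: admissible_def A_carrier) (simp add: A_def)
  have letter: "eval_letter A x = realify (G x)" if "x \<in> set w" for x
  proof (cases x)
    case (Pair j t)
    \<comment> \<open>A symmetric variable occurs in \<open>w\<close> with the tag \<open>Sy\<close>
      only, so the choice made in \<open>A\<close> fits every letter of \<open>w\<close>.\<close>
    have "is_sym_var w j \<longleftrightarrow> t = Sy"
      using sym that unfolding is_sym_var_def Pair by (metis fst_conv snd_conv)
    then show ?thesis
      using A_transpose[of j] by (cases t) (auto simp: Pair A_def)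
  qed
  have prod_carrier: "prod xs \<in> carrier_mat n n" for xs
    unfolding prod_def by (induction xs) (simp, simp add: mult_carrier_mat[OF G])
  have action: "?C (eval_word (n + n) A xs) *\<^sub>v lift v = lift (prod xs *\<^sub>v v)"
    if "set xs \<subseteq> set w" and v: "v \<in> carrier_vec n" for xs v
    using that(1)
  proof (induction xs)
    case Nil
    have "lift v \<in> carrier_vec (n + n)"
      using v by (simp add: lift_def)
    then show ?case
      using v by (simp add: eval_word_def prod_def of_real_hom.mat_hom_one)
  next
    case (Cons x xs)
    have x: "fst x < l" and xs: "\<forall>y\<in>set xs. fst y < l"
      using Cons.prems w by auto
    note c = eval_letter_carrier[OF adm x] eval_word_carrier[OF adm xs]
    have lift: "lift v \<in> carrier_vec (n + n)"
      using v by (simp add: lift_def)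
    have "?C (eval_word (n + n) A (x # xs)) *\<^sub>v lift v
        = (?C (eval_letter A x) * ?C (eval_word (n + n) A xs)) *\<^sub>v lift v"
      using c by (simp add: eval_word_def of_real_hom.mat_hom_mult[of _ "n + n" "n + n" _ "n + n"])
    also have "\<dots> = ?C (realify (G x)) *\<^sub>v lift (prod xs *\<^sub>v v)"
      using c lift Cons letter[of x]
      by (simp add: assoc_mult_mat_vec[of _ "n + n" "n + n" _ "n + n"])
    also have "\<dots> = lift (G x *\<^sub>v (prod xs *\<^sub>v v))"
      unfolding lift_def using realify_mult_lift[OF G mult_mat_vec_carrier[OF prod_carrier v]] .
    also have "\<dots> = lift (prod (x # xs) *\<^sub>v v)"
      using assoc_mult_mat_vec[OF G prod_carrier v, of x xs] by (simp add: prod_def)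
    finally show ?case .
  qed
  obtain v where v: "v \<in> carrier_vec n" "v \<noteq> 0\<^sub>v n" "prod w *\<^sub>v v = c \<cdot>\<^sub>v v"
    using ev prod_carrier[of w] by (auto simp: eigenvalue_def eigenvector_def prod_def)
  have "lift v \<noteq> 0\<^sub>v (n + n)"
  proof
    assume *: "lift v = 0\<^sub>v (n + n)"
    have "v $ i = 0" if "i < n" for i
      using arg_cong[OF *, of "\<lambda>x. x $ i"] that v(1) by (simp add: lift_def)
    then show False
      using v by (auto intro: eq_vecI)
  qed
  moreover have "lift v \<in> carrier_vec (n + n)"
    using v by (simp add: lift_def)
  moreover have "?C (eval_word (n + n) A w) *\<^sub>v lift v = c \<cdot>\<^sub>v lift v"
    unfolding action[OF order.refl v(1)] v(3) using v(1) by (intro eq_vecI) (auto simp: lift_def)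
  moreover have "eval_word (n + n) A w \<in> carrier_mat (n + n) (n + n)"
    using eval_word_carrier[OF adm w] .
  ultimately have "eigenvalue (?C (eval_word (n + n) A w)) c"
    by (auto simp: eigenvalue_def eigenvector_def)
  then show False
    using re adm \<open>c \<notin> \<real>\<close> by (auto simp: real_eigenvalued_def)
qed

text \<open>An eigenvector for a nonzero eigenvalue lies in the range of the projection
  \<open>E\<close>, where \<open>M * E\<close> and \<open>M\<close> agree. This transfers an
  eigenvalue from an invariant subspace to the whole matrix.\<close>

lemma eigenvalue_of_commuting_projection:
  fixes M E :: "'a :: field mat"
  assumes M: "M \<in> carrier_mat n n" and E: "E \<in> carrier_mat n n"
    and EE: "E * E = E" and comm: "M * E = E * M"
    and ev: "eigenvalue (M * E) c" and "c \<noteq> 0"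
  shows "eigenvalue M c"
proof -
  have "eigenvalue ((M * E) * E) c"
    using ev M E by (simp add: EE assoc_mult_mat[of _ n n _ n _ n])
  then have "eigenvalue (E * (M * E)) c"
    using M E \<open>c \<noteq> 0\<close> by (intro eigenvalue_mult_commute[of "M * E" n E]) auto
  then obtain v where v: "v \<in> carrier_vec n" "v \<noteq> 0\<^sub>v n" "(E * (M * E)) *\<^sub>v v = c \<cdot>\<^sub>v v"
    using E by (auto simp: eigenvalue_def eigenvector_def)
  have EME: "E * (M * E) = M * E"
    using M E by (metis EE assoc_mult_mat comm)
  have "c \<cdot>\<^sub>v (E *\<^sub>v v) = E *\<^sub>v (c \<cdot>\<^sub>v v)"
    using v E by (simp add: mult_mat_vec)
  also have "\<dots> = c \<cdot>\<^sub>v v"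
    unfolding v(3)[symmetric] using M E v(1) EME
    by (metis assoc_mult_mat_vec mult_carrier_mat)
  finally have "inverse c \<cdot>\<^sub>v (c \<cdot>\<^sub>v (E *\<^sub>v v)) = inverse c \<cdot>\<^sub>v (c \<cdot>\<^sub>v v)"
    by simp
  then have "E *\<^sub>v v = v"
    using \<open>c \<noteq> 0\<close> by (simp add: smult_smult_assoc)
  then have "M *\<^sub>v v = c \<cdot>\<^sub>v v"
    using v M E EME by (metis assoc_mult_mat_vec)
  then show ?thesis
    using v M by (auto simp: eigenvalue_def eigenvector_def)
qed

section \<open>Walks on the labelled cycle and their weights\<close>

definition cyc :: "'a list \<Rightarrow> int \<Rightarrow> 'a" where
  "cyc w a = w ! nat (a mod int (length w))"

lemma cyc_cong: "a mod int (length w) = b mod int (length w) \<Longrightarrow> cyc w a = cyc w b"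
  by (simp add: cyc_def)

lemma cyc_of_nat: "p < length w \<Longrightarrow> cyc w (int p) = w ! p"
  by (simp add: cyc_def)

lemma cyc_rotate:
  assumes "p < length w"
  shows "rotate j w ! p = cyc w (int j + int p)"
  using assms by (simp add: cyc_def nth_rotate nat_mod_as_int add.commute)

text \<open>The edge from \<open>a\<close> to \<open>a + 1\<close> carries the label
  \<open>cyc w a\<close>, and crossing it backward spells the transposed letter. Walks are followed
  in the integers, which cover the cycle, so that a full turn differs from no turn; a list keeps
  walks with equal displacement apart.\<close>

fun walk_disps :: "word \<Rightarrow> word \<Rightarrow> int \<Rightarrow> int list" where
  "walk_disps w [] a = [0]"
| "walk_disps w (x # xs) a =
    (if cyc w a = x then map (\<lambda>d. d + 1) (walk_disps w xs (a + 1)) else []) @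
    (if cyc w (a - 1) = tr_letter x then map (\<lambda>d. d - 1) (walk_disps w xs (a - 1)) else [])"

lemma walk_disps_bound: "d \<in> set (walk_disps w xs a) \<Longrightarrow> \<bar>d\<bar> \<le> int (length xs)"
  by (induction xs arbitrary: a d) (fastforce split: if_splits)+

lemma walk_disps_parity: "d \<in> set (walk_disps w xs a) \<Longrightarrow> even d \<longleftrightarrow> even (length xs)"
  by (induction xs arbitrary: a d) (fastforce split: if_splits)+

lemma walk_disps_forward:
  assumes "\<And>p. p < length xs \<Longrightarrow> cyc w (a + int p) = xs ! p"
  shows "int (length xs) \<in> set (walk_disps w xs a)"
  using assms
proof (induction xs arbitrary: a)
  case (Cons x xs)
  have "cyc w (a + 1 + int p) = xs ! p" if "p < length xs" for p
    using Cons.prems[of "Suc p"] that by (simp add: algebra_simps)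
  then have "int (length xs) \<in> set (walk_disps w xs (a + 1))"
    by (rule Cons.IH)
  moreover have "cyc w a = x"
    using Cons.prems[of 0] by simp
  ultimately show ?case
    by (auto simp: image_iff)
qed simp

text \<open>A displacement this small leaves no room for a forward step, by
  \<open>walk_disps_bound\<close>. So step number \<open>p\<close> crosses the edge
  \<open>a - 1 - int p\<close> backward.\<close>

lemma walk_disps_backward:
  assumes "- int (length xs) \<in> set (walk_disps w xs a)" "p < length xs"
  shows "cyc w (a - 1 - int p) = tr_letter (xs ! p)"
  using assms
proof (induction xs arbitrary: a p)
  case (Cons x xs)
  have "- int (length (x # xs)) \<noteq> d + 1" if "d \<in> set (walk_disps w xs (a + 1))" for d
    using walk_disps_bound[OF that] by auto
  then have "cyc w (a - 1) = tr_letter x" "- int (length xs) \<in> set (walk_disps w xs (a - 1))"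
    using Cons.prems(1) by (auto split: if_splits)
  then show ?case
    using Cons.IH[of "a - 1" "p - 1"] Cons.prems(2) by (cases p) (auto simp: algebra_simps)
qed simp

text \<open>The weighted adjacency matrix of the steps that spell \<open>x\<close>: forward steps
  weigh \<open>z\<close>, backward steps \<open>cnj z\<close>. The two contributions are added
  because on a cycle of length at most 2 both neighbours of a vertex coincide.\<close>

definition cycle_mat :: "word \<Rightarrow> complex \<Rightarrow> nat \<times> tag \<Rightarrow> complex mat" where
  "cycle_mat w z x = mat (length w) (length w) (\<lambda>(u, v).
     (if v = Suc u mod length w \<and> w ! u = x then z else 0) +
     (if u = Suc v mod length w \<and> w ! v = tr_letter x then cnj z else 0))"

lemma cycle_mat_carrier: "cycle_mat w z x \<in> carrier_mat (length w) (length w)"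
  by (simp add: cycle_mat_def)

text \<open>Traversing a step in the opposite direction transposes its letter and conjugates its
  weight.\<close>

lemma cycle_mat_tr_letter: "cycle_mat w z (tr_letter x) = adjoint_mat (cycle_mat w z x)"
  by (rule eq_matI) (auto simp: cycle_mat_def adjoint_mat_def)

text \<open>Translates adjacency of the vertices below \<open>k\<close> into shifts by one in the
  integers, where the walks live.\<close>

lemma nat_mod_succ_eq_iff:
  assumes "k > 0" "t < k"
  shows "t = Suc (nat (a mod int k)) mod k \<longleftrightarrow> t = nat ((a + 1) mod int k)"
    and "nat (a mod int k) = Suc t mod k \<longleftrightarrow> t = nat ((a - 1) mod int k)"
proof -
  have a: "int (nat (a mod int k)) = a mod int k" for a
    using assms by simp
  have "int (Suc (nat (a mod int k)) mod k) = (a + 1) mod int k"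
    by (simp only: zmod_int int_Suc a mod_add_left_eq)
  then show "t = Suc (nat (a mod int k)) mod k \<longleftrightarrow> t = nat ((a + 1) mod int k)"
    by (metis nat_int)
  have "nat (a mod int k) = Suc t mod k \<longleftrightarrow> a mod int k = (int t + 1) mod int k"
    by (simp only: a zmod_int int_Suc flip: of_nat_eq_iff[where 'a = int])
  also have "\<dots> \<longleftrightarrow> (a - 1) mod int k = int t mod int k"
    by (simp add: mod_eq_dvd_iff algebra_simps)
  also have "\<dots> \<longleftrightarrow> t = nat ((a - 1) mod int k)"
    using assms a[of "a - 1"] by auto
  finally show "nat (a mod int k) = Suc t mod k \<longleftrightarrow> t = nat ((a - 1) mod int k)" .
qed

lemma cycle_mat_product_carrier:
  "foldr (\<lambda>x M. cycle_mat w z x * M) xs (1\<^sub>m (length w)) \<in> carrier_mat (length w) (length w)"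
  by (induction xs) (simp, simp add: mult_carrier_mat[OF cycle_mat_carrier])

text \<open>Induction on the word: a row of the first factor is supported on the two neighbours of
  its vertex, and the factors \<open>cis t\<close> and \<open>cis (- t)\<close> match the
  displacements 1 and -1. The start \<open>a\<close> is any integer, since a walk may leave the
  range from 0 to \<open>k - 1\<close>.\<close>

lemma cycle_mat_product_entry:
  fixes w xs :: word and t :: real
  defines "k \<equiv> length w"
  defines "R \<equiv> \<lambda>xs. foldr (\<lambda>x M. cycle_mat w (cis t) x * M) xs (1\<^sub>m k)"
  assumes "k > 0" and v: "v < k"
  shows "R xs $$ (nat (a mod int k), v) =
    (\<Sum>d\<leftarrow>walk_disps w xs a. if (a + d) mod int k = int v then cis (t * of_int d) else 0)"
proof (induction xs arbitrary: a)
  case Nil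
  have "nat (a mod int k) < k"
    using \<open>k > 0\<close> by (simp add: nat_less_iff)
  moreover have "nat (a mod int k) = v \<longleftrightarrow> a mod int k = int v"
    using \<open>k > 0\<close> by auto
  ultimately show ?case
    using v by (simp add: R_def)
next
  case (Cons x xs)
  define n where "n a = nat (a mod int k)" for a
  have n: "n a < k" for a
    using \<open>k > 0\<close> by (simp add: n_def nat_less_iff)
  have succ: "s = Suc (n a) mod k \<longleftrightarrow> s = n (a + 1)" "n a = Suc s mod k \<longleftrightarrow> s = n (a - 1)"
    if "s < k" for s
    using nat_mod_succ_eq_iff[OF \<open>k > 0\<close> that] by (simp_all add: n_def)
  have cyc: "w ! n a = cyc w a" for a
    by (simp add: cyc_def n_def k_def)
  have Rc: "R xs \<in> carrier_mat k k"
    using cycle_mat_product_carrier by (simp add: R_def k_def)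
  have Gc: "cycle_mat w (cis t) x \<in> carrier_mat k k"
    using cycle_mat_carrier by (simp add: k_def)
  let ?S = "\<lambda>a. \<Sum>d\<leftarrow>walk_disps w xs a. if (a + d) mod int k = int v then cis (t * of_int d) else 0"
  have IH: "R xs $$ (n a, v) = ?S a" for a
    using Cons.IH by (simp add: n_def)
  have "R (x # xs) $$ (n a, v) = (cycle_mat w (cis t) x * R xs) $$ (n a, v)"
    by (simp add: R_def)
  also have "\<dots> = (\<Sum>s<k. cycle_mat w (cis t) x $$ (n a, s) * R xs $$ (s, v))"
    using Rc Gc n v by (simp add: scalar_prod_def lessThan_atLeast0)
  also have "\<dots> = (\<Sum>s<k. (if s = n (a + 1) then (if cyc w a = x then cis t * R xs $$ (s, v) else 0) else 0)
      + (if s = n (a - 1) then (if cyc w (a - 1) = tr_letter x then cis (- t) * R xs $$ (s, v) else 0) else 0))"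
  proof (intro sum.cong refl)
    fix s
    assume "s \<in> {..<k}"
    then have s: "s < k"
      by simp
    have "cycle_mat w (cis t) x $$ (n a, s) = (if s = Suc (n a) mod k \<and> w ! n a = x then cis t else 0)
        + (if n a = Suc s mod k \<and> w ! s = tr_letter x then cis (- t) else 0)"
      using s n[of a] by (simp add: cycle_mat_def cis_cnj k_def)
    also have "\<dots> = (if s = n (a + 1) \<and> cyc w a = x then cis t else 0)
        + (if s = n (a - 1) \<and> cyc w (a - 1) = tr_letter x then cis (- t) else 0)"
      unfolding succ[OF s] by (simp add: cyc cong: conj_cong)
    finally have "cycle_mat w (cis t) x $$ (n a, s) = (if s = n (a + 1) \<and> cyc w a = x then cis t else 0)
        + (if s = n (a - 1) \<and> cyc w (a - 1) = tr_letter x then cis (- t) else 0)" .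
    then show "cycle_mat w (cis t) x $$ (n a, s) * R xs $$ (s, v) =
       (if s = n (a + 1) then (if cyc w a = x then cis t * R xs $$ (s, v) else 0) else 0)
      + (if s = n (a - 1) then (if cyc w (a - 1) = tr_letter x then cis (- t) * R xs $$ (s, v) else 0) else 0)"
      by (simp add: distrib_right)
  qed
  also have "\<dots> = (if cyc w a = x then cis t * ?S (a + 1) else 0)
      + (if cyc w (a - 1) = tr_letter x then cis (- t) * ?S (a - 1) else 0)"
    using n by (simp add: sum.distrib IH)
  also have "\<dots> = (\<Sum>d\<leftarrow>walk_disps w (x # xs) a. if (a + d) mod int k = int v then cis (t * of_int d) else 0)"
  proof -
    have 1: "cis t * ?S (a + 1) = (\<Sum>d\<leftarrow>map (\<lambda>d. d + 1) (walk_disps w xs (a + 1)).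
        if (a + d) mod int k = int v then cis (t * of_int d) else 0)"
      by (auto simp: sum_list_const_mult[symmetric] comp_def cis_mult algebra_simps
          intro!: arg_cong[of _ _ sum_list])
    have 2: "cis (- t) * ?S (a - 1) = (\<Sum>d\<leftarrow>map (\<lambda>d. d - 1) (walk_disps w xs (a - 1)).
        if (a + d) mod int k = int v then cis (t * of_int d) else 0)"
      by (auto simp: sum_list_const_mult[symmetric] comp_def cis_mult algebra_simps
          intro!: arg_cong[of _ _ sum_list])
    show ?thesis
      unfolding 1 2 by simp
  qed
  finally show ?case
    by (simp add: n_def)
qed

text \<open>The reflection sends edge p to edge u - 1 - p. Position p of the word rotated by
  \<open>j\<close> is edge j + p, and for u congruent to 2j it goes to edge j - 1 - p, the mirror
  position counted from the end.\<close>

lemma palindromic_rotation_of_reflection: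
  assumes refl: "\<And>p. p < length w \<Longrightarrow> cyc w (u - 1 - int p) = tr_letter (w ! p)"
    and u: "u = 2 * int j \<or> u + int (length w) = 2 * int j"
  shows "wtrans (rotate j w) = rotate j w"
proof (rule nth_equalityI)
  let ?k = "int (length w)"
  fix p
  assume "p < length (wtrans (rotate j w))"
  then have p: "p < length w"
    by simp
  \<comment> \<open>The index in \<open>w\<close> of the letter that stands at the mirror position
    of \<open>p\<close> in the rotated word.\<close>
  define q where "q = nat ((int j - 1 - int p) mod ?k)"
  have "?k > 0"
    using p by linarith
  then have q: "q < length w" "int q = (int j - 1 - int p) mod ?k"
    by (simp_all add: q_def nat_less_iff)
  have "wtrans (rotate j w) ! p = tr_letter (rotate j w ! (length w - Suc p))"
    using p by (simp add: wtrans_def rev_nth)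
  also have "rotate j w ! (length w - Suc p) = cyc w (int j + int (length w - Suc p))"
    using p by (intro cyc_rotate) simp
  also have "\<dots> = cyc w (int q)"
  proof (rule cyc_cong)
    have eq: "int j + int (length w - Suc p) = (int j - 1 - int p) + ?k"
      using p by (simp add: of_nat_diff)
    show "(int j + int (length w - Suc p)) mod ?k = int q mod ?k"
      by (simp only: eq q mod_add_self2 mod_mod_trivial)
  qed
  also have "tr_letter (cyc w (int q)) = cyc w (u - 1 - int q)"
    using refl[OF q(1)] q(1) by (simp add: cyc_of_nat)
  also have "\<dots> = cyc w (int j + int p)"
  proof (rule cyc_cong)
    have "(u - 1 - int q) mod ?k = (u - 1 - (int j - 1 - int p)) mod ?k"
      unfolding q by (simp add: mod_diff_right_eq)
    also have "\<dots> = (int j + int p) mod ?k"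
      using u
    proof
      assume "u + ?k = 2 * int j"
      then have "int j + int p = (u - 1 - (int j - 1 - int p)) + ?k"
        by simp
      then show ?thesis
        by (metis mod_add_self2)
    qed (simp add: algebra_simps)
    finally show "(u - 1 - int q) mod ?k = (int j + int p) mod ?k" .
  qed
  also have "\<dots> = rotate j w ! p"
    using p by (simp add: cyc_rotate)
  finally show "wtrans (rotate j w) ! p = rotate j w ! p" .
qed simp

text \<open>The number of turns \<open>m\<close> is -1, 0 or 1, and the first is excluded. One
  forward turn has the angle pi / 2, no turn has the angle 0.\<close>

lemma Im_closed_walk_weight:
  assumes "k > 0" "\<bar>d\<bar> \<le> int k" "d mod int k = 0" "d \<noteq> - int k"
  shows "Im (cis (pi / (2 * real k) * of_int d)) = (if d = int k then 1 else 0)"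
proof -
  obtain m where m: "d = int k * m"
    using assms(3) by (metis mod_0_imp_dvd dvdE)
  have "\<bar>m\<bar> \<le> 1"
  proof -
    have "int k * \<bar>m\<bar> \<le> int k * 1"
      using assms(2) by (simp add: m abs_mult)
    then show ?thesis
      using assms(1) by simp
  qed
  moreover have "m \<noteq> - 1"
    using assms(4) m by auto
  ultimately have "m = 0 \<or> m = 1"
    by linarith
  then show ?thesis
    using assms(1) m by (auto simp: field_simps)
qed

section \<open>The trace of the product over the good vertices\<close>

lemma palindromic_rotation_of_real_eigenvalued:
  assumes w: "\<forall>x\<in>set w. fst x < l" and "w \<noteq> []"
    and sym: "\<forall>x\<in>set w. \<forall>y\<in>set w. fst x = fst y \<longrightarrow> snd x = Sy \<longrightarrow> snd y = Sy"
    and re: "real_eigenvalued l w"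
  shows "\<exists>j. wtrans (rotate j w) = rotate j w"
proof (rule ccontr)
  assume no_pal: "\<nexists>j. wtrans (rotate j w) = rotate j w"
  define k where "k = length w"
  have k: "k > 0"
    using \<open>w \<noteq> []\<close> by (simp add: k_def)
  \<comment> \<open>Chosen so that \<open>k\<close> forward steps have the total weight
    \<open>\<i>\<close>.\<close>
  define t where "t = pi / (2 * real k)"
  define M where "M = foldr (\<lambda>x M. cycle_mat w (cis t) x * M) w (1\<^sub>m k)"
  \<comment> \<open>These are the vertices for which \<open>u\<close> or \<open>u + k\<close> is
    even, as \<open>palindromic_rotation_of_reflection\<close> demands; \<open>E\<close> projects
    onto their span.\<close>
  define good where "good u \<longleftrightarrow> odd k \<or> even u" for u :: nat
  define E where "E = mat k k (\<lambda>(u, v). if u = v then if good u then 1 else 0 else 0 :: complex)"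
  have M: "M \<in> carrier_mat k k"
    using cycle_mat_product_carrier by (simp add: M_def k_def)
  have E: "E \<in> carrier_mat k k"
    by (simp add: E_def)
  have entry: "M $$ (u, v) = (\<Sum>d\<leftarrow>walk_disps w w (int u).
      if (int u + d) mod int k = int v then cis (t * of_int d) else 0)" if "u < k" "v < k" for u v
    using cycle_mat_product_entry[of w v t w "int u"] that k by (simp add: M_def k_def)
  \<comment> \<open>Good and bad vertices both exist only for even \<open>k\<close>. Then all
    displacements are even, and reduction modulo \<open>k\<close> preserves parity.\<close>
  have M_block: "M $$ (u, v) = 0" if "u < k" "v < k" "good u \<noteq> good v" for u v
  proof -
    have "(int u + d) mod int k \<noteq> int v" if "d \<in> set (walk_disps w w (int u))" for d
    proof
      assume "(int u + d) mod int k = int v"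
      moreover have "even (int k)"
        using \<open>good u \<noteq> good v\<close> by (auto simp: good_def)
      moreover have "even d"
        using walk_disps_parity[OF that] \<open>even (int k)\<close> by (simp add: k_def)
      ultimately have "even (int u) \<longleftrightarrow> even (int v)"
        by (metis dvd_mod_iff even_add)
      then show False
        using \<open>good u \<noteq> good v\<close> by (auto simp: good_def)
    qed
    then show ?thesis
      unfolding entry[OF that(1,2)] by (simp cong: map_cong)
  qed
  have ME: "M * E = mat k k (\<lambda>(u, v). if good v then M $$ (u, v) else 0)"
    using M by (intro eq_matI) (auto simp: E_def scalar_prod_def if_distrib cong: if_cong)
  have EM: "E * M = mat k k (\<lambda>(u, v). if good u then M $$ (u, v) else 0)"
    using M by (intro eq_matI) (auto simp: E_def scalar_prod_def if_distrib[of "\<lambda>x. x * _"] cong: if_cong)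
  have comm: "M * E = E * M"
    unfolding ME EM using M_block by (intro eq_matI) auto
  have EE: "E * E = E"
    by (intro eq_matI) (auto simp: E_def scalar_prod_def if_distrib cong: if_cong)
  have weight: "Im (if (int u + d) mod int k = int u then cis (t * of_int d) else 0) = (if d = int k then 1 else 0)"
    if u: "u < k" "good u" and d: "d \<in> set (walk_disps w w (int u))" for u d
  proof (cases "(int u + d) mod int k = int u")
    case True
    then have "d mod int k = 0"
      using u(1) by (metis add_diff_cancel_left' mod_diff_left_eq cancel_comm_monoid_add_class.diff_cancel mod_0)
    moreover have "\<bar>d\<bar> \<le> int k"
      using walk_disps_bound[OF d] by (simp add: k_def)
    moreover have "d \<noteq> - int k"
    proof
      assume "d = - int k"
      then have refl: "cyc w (int u - 1 - int p) = tr_letter (w ! p)" if "p < length w" for p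
        using walk_disps_backward[of w w "int u" p] d that by (simp add: k_def)
      have "even u \<or> even (u + k)"
        using u(2) by (auto simp: good_def)
      then obtain j where "u = 2 * j \<or> u + k = 2 * j"
        by (metis evenE)
      then show False
        using palindromic_rotation_of_reflection[OF refl, of j] no_pal by (force simp: k_def)
    qed
    ultimately show ?thesis
      using Im_closed_walk_weight[OF k] True by (simp add: t_def)
  next
    case False
    \<comment> \<open>Displacement \<open>k\<close> always returns to the start, so a walk that does
      not close up gives zero on both sides.\<close>
    then have "d \<noteq> int k"
      using u(1) by auto
    then show ?thesis
      using False by simp
  qed
  have diag: "Im (M $$ (u, u)) = (\<Sum>d\<leftarrow>walk_disps w w (int u). if d = int k then 1 else 0)"
    if "u < k" "good u" for u
  proof -
    have "Im (sum_list zs) = (\<Sum>z\<leftarrow>zs. Im z)" for zs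
      by (induction zs) auto
    then show ?thesis
      unfolding entry[OF that(1,1)] using weight[OF that]
      by (simp add: comp_def cong: map_cong)
  qed
  have nonneg: "Im (M $$ (u, u)) \<ge> 0" if "u < k" "good u" for u
    unfolding diag[OF that] by (intro sum_list_nonneg) auto
  \<comment> \<open>The forward walk once around from vertex 0, which is good for every
    \<open>k\<close>, spells \<open>w\<close> itself. As no diagonal entry at a good vertex has
    negative imaginary part, this one walk makes the trace nonreal.\<close>
  have "int k \<in> set (walk_disps w w (int 0))"
    using walk_disps_forward[of w w 0] by (simp add: k_def cyc_of_nat)
  then have "(1 :: real) \<in> set (map (\<lambda>d. if d = int k then 1 else 0) (walk_disps w w (int 0)))"
    by force
  then have "(1 :: real) \<le> (\<Sum>d\<leftarrow>walk_disps w w (int 0). if d = int k then 1 else 0)"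
    by (intro member_le_sum_list) auto
  then have pos: "Im (M $$ (0, 0)) > 0"
    using diag[of 0] k by (simp add: good_def)
  have "Im (mat_trace (M * E)) = (\<Sum>u<k. if good u then Im (M $$ (u, u)) else 0)"
    unfolding ME by (auto simp: mat_trace_def intro!: sum.cong)
  also have "\<dots> > 0"
    using pos nonneg k by (intro sum_pos2[of _ 0]) (auto simp: good_def)
  finally have "Im (mat_trace (M * E)) \<noteq> 0"
    by simp
  then obtain c where c: "eigenvalue (M * E) c" "c \<notin> \<real>"
    using nonreal_eigenvalue_of_nonreal_trace[of "M * E" k] M E by auto
  \<comment> \<open>Being nonreal, \<open>c\<close> is nonzero, as the passage from
    \<open>M * E\<close> to \<open>M\<close> requires.\<close>
  then have "eigenvalue M c"
    using eigenvalue_of_commuting_projection[OF M E EE comm c(1)] c(2) by (metis Reals_0)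
  then show False
    using not_real_eigenvalued_of_complex_family[OF w sym, of "cycle_mat w (cis t)" k c]
      cycle_mat_carrier cycle_mat_tr_letter c(2) re
    by (simp add: M_def k_def)
qed

theorem mainTheorem3:
  fixes l k :: nat and w :: word
  assumes "symbolic_product l k w"
  shows "real_eigenvalued l w \<longleftrightarrow>
    ((even k \<and> (\<exists>j<k. let r = rotate j w; L = take (k div 2) r in r = L @ wtrans L)) \<or>
     (odd k \<and> (\<exists>j<k. let r = rotate j w; L = take ((k - 1) div 2) r in
        snd (last r) = Sy \<and> r = L @ wtrans L @ [(fst (last r), Sy)])))"
proof -
  have w: "length w = k" "k > 0" "w \<noteq> []" "\<forall>x\<in>set w. fst x < l"
    "\<forall>x\<in>set w. \<forall>y\<in>set w. fst x = fst y \<longrightarrow> snd x = Sy \<longrightarrow> snd y = Sy"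
    using assms unfolding symbolic_product_def by (blast | force)+
  have "real_eigenvalued l w \<longleftrightarrow> (\<exists>j. wtrans (rotate j w) = rotate j w)"
    using palindromic_rotation_of_real_eigenvalued[OF w(4,3,5)]
      real_eigenvalued_of_palindromic_rotation[OF w(4)] by blast
  then show ?thesis
    unfolding palindromic_rotation_iff[OF w(1,2)] .
qed

end
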